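(* Let $(\mathcal C,U)$ be a UD-category. An object of $\mathcal C$ is projective if and only if it is isomorphic to a coproduct of indecomposable projective objects.
   Context: A concrete category over the category $\mathrm{Set}$ of sets is a pair $(\mathcal C,U)$, where $\mathcal C$ is a category and $U:\mathcal C\to \mathrm{Set}$ is a faithful functor. $\mathcal C$ is coproduct complete if it has coproducts of all families of objects; it is balanced if every morphism that is both a monomorphism and an epimorphism is an isomorphism. A subobject of an object $A$ is a pair $(S,\nu)$ with $\nu:S\to A$ a monomorphism. In a coproduct complete category with initial object $\theta\cong\coprod\emptyset$, an object is indecomposable if it is not isomorphic to an initial object nor to a coproduct of two non-initial objects. A concrete category $(\mathcal C,U)$ over $\mathrm{Set}$ is a UD-category if: (UD1) $\mathcal C$ is a coproduct complete balanced category with an initial object $\theta\cong\coprod\emptyset$, for which each morphism $\theta\to A$ is a monomorphism and there is at most one morphism $A\to\theta$, for every object $A$; (UD2) for any morphism $f:A\to B$ there exists a subobject $(A^f,\iota)$ of $B$ such that $U(A^f)=U(f)(U(A))\subseteq U(B)$ and $U(\iota)$ is the subset inclusion map; (UD3) for each morphism $f:A\to B$ and every subobject $(S,\nu)$ of $B$ with $U(f)(U(A))\subseteq U(\nu)(U(S))$ there exists a morphism $g:A\to S$ with $f=\nu g$; (UD4) for every nonempty family $(A_i,\nu_i)_{i\in I}$ of subobjects of an object $A$ there exist subobjects $(\bigcap_i A_i^{\nu_i},\iota_\cap)$ and $(\bigcup_i A_i^{\nu_i},\iota_\cup)$ of $A$ such that $U(\bigcap_i A_i^{\nu_i})=\bigcap_i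 U(\nu_i)(U(A_i))=\bigcap_i U(A_i^{\nu_i})$, $U(\bigcup_i A_i^{\nu_i})=\bigcup_i U(\nu_i)(U(A_i))=\bigcup_i U(A_i^{\nu_i})$ and $U(\iota_\cap),U(\iota_\cup)$ are the subset inclusion maps; (UD5) if $(A,(\nu_0,\nu_1))$ is a coproduct of a pair of objects $(A_0,A_1)$, then $\nu_0,\nu_1$ are monomorphisms and $A_0^{\nu_0}\cap A_1^{\nu_1}$ is isomorphic to $\theta$; (UD6) for every noninitial object $A$ and every $x\in U(A)$ there exists an indecomposable subobject $(B,\nu)$ of $A$ such that $x\in U(\nu)(U(B))$. An object $P$ of $\mathcal C$ is projective if for every epimorphism $\pi:A\to B$ and every morphism $\alpha:P\to B$ in $\mathcal C$ there exists a morphism $\overline\alpha:P\to A$ with $\alpha=\pi\overline\alpha$. Coproducts of families include the empty coproduct $\theta$. *)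

theory Defs
  imports Main "HOL-Library.FuncSet"
begin

section \<open>Categories\<close>

record ('o, 'm) cat =
  Obj  :: "'o set"
  Arr  :: "'m set"
  Dom  :: "'m \<Rightarrow> 'o"
  Cod  :: "'m \<Rightarrow> 'o"
  Id   :: "'o \<Rightarrow> 'm"
  Comp :: "'m \<Rightarrow> 'm \<Rightarrow> 'm"  (infixr "\<cdot>\<index>" 55)

definition Hom :: "('o, 'm) cat \<Rightarrow> 'o \<Rightarrow> 'o \<Rightarrow> 'm set" where
  "Hom C A B = {f \<in> Arr C. Dom C f = A \<and> Cod C f = B}"

locale category =
  fixes C :: "('o, 'm) cat" (structure)
  assumes Dom_Obj: "f \<in> Arr C \<Longrightarrow> Dom C f \<in> Obj C"
    and Cod_Obj: "f \<in> Arr C \<Longrightarrow> Cod C f \<in> Obj C"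
    and Id_Hom: "A \<in> Obj C \<Longrightarrow> Id C A \<in> Hom C A A"
    and Comp_Hom: "f \<in> Hom C A B \<Longrightarrow> g \<in> Hom C B D \<Longrightarrow> g \<cdot> f \<in> Hom C A D"
    and Comp_Id: "f \<in> Hom C A B \<Longrightarrow> f \<cdot> Id C A = f"
    and Id_Comp: "f \<in> Hom C A B \<Longrightarrow> Id C B \<cdot> f = f"
    and Comp_assoc: "f \<in> Hom C A B \<Longrightarrow> g \<in> Hom C B D \<Longrightarrow> h \<in> Hom C D E \<Longrightarrow>
           (h \<cdot> g) \<cdot> f = h \<cdot> (g \<cdot> f)"

definition mono_arr :: "('o, 'm) cat \<Rightarrow> 'm \<Rightarrow> bool" where
  "mono_arr C f \<longleftrightarrow> f \<in> Arr C \<and>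
     (\<forall>X. \<forall>g \<in> Hom C X (Dom C f). \<forall>h \<in> Hom C X (Dom C f). f \<cdot>\<^bsub>C\<^esub> g = f \<cdot>\<^bsub>C\<^esub> h \<longrightarrow> g = h)"

definition epi_arr :: "('o, 'm) cat \<Rightarrow> 'm \<Rightarrow> bool" where
  "epi_arr C f \<longleftrightarrow> f \<in> Arr C \<and>
     (\<forall>X. \<forall>g \<in> Hom C (Cod C f) X. \<forall>h \<in> Hom C (Cod C f) X. g \<cdot>\<^bsub>C\<^esub> f = h \<cdot>\<^bsub>C\<^esub> f \<longrightarrow> g = h)"

definition iso_arr :: "('o, 'm) cat \<Rightarrow> 'm \<Rightarrow> bool" where
  "iso_arr C f \<longleftrightarrow> f \<in> Arr C \<and>
     (\<exists>g \<in> Hom C (Cod C f) (Dom C f).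
        g \<cdot>\<^bsub>C\<^esub> f = Id C (Dom C f) \<and> f \<cdot>\<^bsub>C\<^esub> g = Id C (Cod C f))"

definition isomorphic :: "('o, 'm) cat \<Rightarrow> 'o \<Rightarrow> 'o \<Rightarrow> bool" where
  "isomorphic C A B \<longleftrightarrow> (\<exists>f \<in> Hom C A B. iso_arr C f)"

definition balanced :: "('o, 'm) cat \<Rightarrow> bool" where
  "balanced C \<longleftrightarrow> (\<forall>f. mono_arr C f \<and> epi_arr C f \<longrightarrow> iso_arr C f)"

definition initial :: "('o, 'm) cat \<Rightarrow> 'o \<Rightarrow> bool" where
  "initial C T \<longleftrightarrow> T \<in> Obj C \<and> (\<forall>A \<in> Obj C. \<exists>!f. f \<in> Hom C T A)"

definition subobject :: "('o, 'm) cat \<Rightarrow> 'o \<Rightarrow> 'm \<Rightarrow> 'o \<Rightarrow> bool" where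
  "subobject C S \<nu> A \<longleftrightarrow> \<nu> \<in> Hom C S A \<and> mono_arr C \<nu>"

definition is_coproduct ::
    "('o, 'm) cat \<Rightarrow> 'i set \<Rightarrow> ('i \<Rightarrow> 'o) \<Rightarrow> 'o \<Rightarrow> ('i \<Rightarrow> 'm) \<Rightarrow> bool" where
  "is_coproduct C I F Q \<nu> \<longleftrightarrow>
     Q \<in> Obj C \<and> (\<forall>i\<in>I. F i \<in> Obj C \<and> \<nu> i \<in> Hom C (F i) Q) \<and>
     (\<forall>X \<in> Obj C. \<forall>f. (\<forall>i\<in>I. f i \<in> Hom C (F i) X) \<longrightarrow>
        (\<exists>!h. h \<in> Hom C Q X \<and> (\<forall>i\<in>I. h \<cdot>\<^bsub>C\<^esub> \<nu> i = f i)))"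

abbreviation pair_family :: "'a \<Rightarrow> 'a \<Rightarrow> nat \<Rightarrow> 'a" where
  "pair_family a b \<equiv> (\<lambda>i. if i = 0 then a else b)"

definition is_coproduct2 ::
    "('o, 'm) cat \<Rightarrow> 'o \<Rightarrow> 'o \<Rightarrow> 'o \<Rightarrow> 'm \<Rightarrow> 'm \<Rightarrow> bool" where
  "is_coproduct2 C A0 A1 Q \<nu>0 \<nu>1 \<longleftrightarrow>
     is_coproduct C {0, 1} (pair_family A0 A1) Q (pair_family \<nu>0 \<nu>1)"

definition indecomposable :: "('o, 'm) cat \<Rightarrow> 'o \<Rightarrow> bool" where
  "indecomposable C A \<longleftrightarrow> A \<in> Obj C \<and>
     \<not> (\<exists>T. initial C T \<and> isomorphic C A T) \<and>
     \<not> (\<exists>A0 A1 Q \<nu>0 \<nu>1. A0 \<in> Obj C \<and> A1 \<in> Obj C \<and> \<not> initial C A0 \<and> \<not> initial C A1 \<and>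
          is_coproduct2 C A0 A1 Q \<nu>0 \<nu>1 \<and> isomorphic C A Q)"

definition projective :: "('o, 'm) cat \<Rightarrow> 'o \<Rightarrow> bool" where
  "projective C P \<longleftrightarrow> P \<in> Obj C \<and>
     (\<forall>A B. \<forall>\<pi> \<in> Hom C A B. \<forall>\<alpha> \<in> Hom C P B. epi_arr C \<pi> \<longrightarrow>
        (\<exists>\<beta> \<in> Hom C P A. \<alpha> = \<pi> \<cdot>\<^bsub>C\<^esub> \<beta>))"

section \<open>Concrete categories over Set\<close>

text \<open>
  HOL has no type of all sets, so the distinction between sets and proper classes is made
  relative to a type \<open>'e\<close>: a predicate singles out the small subsets of \<open>'e\<close>, and Set is
  the category of small subsets of \<open>'e\<close>. Here \<open>'e\<close> may be a Grothendieck universe with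
  its members as the small sets; since closure under power sets is not demanded, \<open>'e\<close> may also be any
  infinite type all of whose subsets are small. A family is one indexed by a small set.
\<close>
locale small_sets =
  fixes small :: "'e set \<Rightarrow> bool"
  assumes small_subset: "small X \<Longrightarrow> Y \<subseteq> X \<Longrightarrow> small Y"
    and small_UN: "small I \<Longrightarrow> (\<And>i. i \<in> I \<Longrightarrow> small (F i)) \<Longrightarrow> small (\<Union>i\<in>I. F i)"
    and small_infinite: "\<exists>X. small X \<and> infinite X"

definition coproduct_complete :: "('o, 'm) cat \<Rightarrow> ('e set \<Rightarrow> bool) \<Rightarrow> bool" where
  "coproduct_complete C small \<longleftrightarrow>
     (\<forall>(I :: 'e set) F. small I \<and> (\<forall>i\<in>I. F i \<in> Obj C) \<longrightarrow> (\<exists>Q \<nu>. is_coproduct C I F Q \<nu>))"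

text \<open>
  \<open>UO\<close> and \<open>UA\<close> are the object and the arrow part of the functor \<open>U\<close>. Only the values of
  \<open>UA f\<close> on \<open>UO (Dom C f)\<close> matter; equality of maps in Set is equality on the domain.
\<close>
locale concrete_category = category C + small_sets small
  for C :: "('o, 'm) cat" (structure) and small :: "'e set \<Rightarrow> bool" +
  fixes UO :: "'o \<Rightarrow> 'e set" and UA :: "'m \<Rightarrow> 'e \<Rightarrow> 'e"
  assumes UO_small: "A \<in> Obj C \<Longrightarrow> small (UO A)"
    and UA_funcset: "f \<in> Hom C A B \<Longrightarrow> UA f \<in> UO A \<rightarrow> UO B"
    and UA_Id: "A \<in> Obj C \<Longrightarrow> x \<in> UO A \<Longrightarrow> UA (Id C A) x = x"
    and UA_Comp: "f \<in> Hom C A B \<Longrightarrow> g \<in> Hom C B D \<Longrightarrow> x \<in> UO A \<Longrightarrow>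
           UA (g \<cdot> f) x = UA g (UA f x)"
    and UA_faithful: "f \<in> Hom C A B \<Longrightarrow> g \<in> Hom C A B \<Longrightarrow>
           (\<And>x. x \<in> UO A \<Longrightarrow> UA f x = UA g x) \<Longrightarrow> f = g"
begin

definition inclusion_subobject :: "'o \<Rightarrow> 'm \<Rightarrow> 'o \<Rightarrow> bool" where
  "inclusion_subobject S \<iota> A \<longleftrightarrow>
     subobject C S \<iota> A \<and> UO S \<subseteq> UO A \<and> (\<forall>x \<in> UO S. UA \<iota> x = x)"

definition is_intersection ::
    "'i set \<Rightarrow> ('i \<Rightarrow> 'o) \<Rightarrow> ('i \<Rightarrow> 'm) \<Rightarrow> 'o \<Rightarrow> 'o \<Rightarrow> 'm \<Rightarrow> bool" where
  "is_intersection I S \<nu> A D \<iota> \<longleftrightarrow>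
     inclusion_subobject D \<iota> A \<and> UO D = (\<Inter>i\<in>I. UA (\<nu> i) ` UO (S i))"

definition is_union ::
    "'i set \<Rightarrow> ('i \<Rightarrow> 'o) \<Rightarrow> ('i \<Rightarrow> 'm) \<Rightarrow> 'o \<Rightarrow> 'o \<Rightarrow> 'm \<Rightarrow> bool" where
  "is_union I S \<nu> A D \<iota> \<longleftrightarrow>
     inclusion_subobject D \<iota> A \<and> UO D = (\<Union>i\<in>I. UA (\<nu> i) ` UO (S i))"

end

section \<open>UD-categories\<close>

text \<open>
  The object called \<open>\<theta>\<close> in the axioms is unique only up to isomorphism, so what is required of it is
  required of every initial object. Likewise UD5 speaks about every intersection subobject
  (one exists by UD4, and UD3 makes any two isomorphic).
\<close>
locale UD_category = concrete_category C small UO UA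
  for C :: "('o, 'm) cat" (structure) and small :: "'e set \<Rightarrow> bool"
    and UO :: "'o \<Rightarrow> 'e set" and UA :: "'m \<Rightarrow> 'e \<Rightarrow> 'e" +
  assumes UD1_coproducts: "coproduct_complete C small"
    and UD1_balanced: "balanced C"
    and UD1_initial: "\<exists>\<theta> F Q \<nu>. initial C \<theta> \<and>
           is_coproduct C ({} :: 'e set) F Q \<nu> \<and> isomorphic C \<theta> Q"
    and UD1_from_initial: "initial C \<theta> \<Longrightarrow> A \<in> Obj C \<Longrightarrow> f \<in> Hom C \<theta> A \<Longrightarrow> mono_arr C f"
    and UD1_to_initial: "initial C \<theta> \<Longrightarrow> A \<in> Obj C \<Longrightarrow> f \<in> Hom C A \<theta> \<Longrightarrow> g \<in> Hom C A \<theta> \<Longrightarrow> f = g"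
    and UD2: "f \<in> Hom C A B \<Longrightarrow> \<exists>S \<iota>. inclusion_subobject S \<iota> B \<and> UO S = UA f ` UO A"
    and UD3: "f \<in> Hom C A B \<Longrightarrow> subobject C S \<nu> B \<Longrightarrow> UA f ` UO A \<subseteq> UA \<nu> ` UO S \<Longrightarrow>
           \<exists>g \<in> Hom C A S. f = \<nu> \<cdot> g"
    and UD4: "A \<in> Obj C \<Longrightarrow> small I \<Longrightarrow> I \<noteq> {} \<Longrightarrow> (\<And>i. i \<in> I \<Longrightarrow> subobject C (F i) (\<mu> i) A) \<Longrightarrow>
           (\<exists>D \<iota>. is_intersection I F \<mu> A D \<iota>) \<and> (\<exists>D \<iota>. is_union I F \<mu> A D \<iota>)"
    and UD5: "is_coproduct2 C A0 A1 A \<nu>0 \<nu>1 \<Longrightarrow>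
           mono_arr C \<nu>0 \<and> mono_arr C \<nu>1 \<and>
           (\<forall>D \<iota> \<theta>. is_intersection {0, 1} (pair_family A0 A1) (pair_family \<nu>0 \<nu>1) A D \<iota> \<longrightarrow>
              initial C \<theta> \<longrightarrow> isomorphic C D \<theta>)"
    and UD6: "A \<in> Obj C \<Longrightarrow> \<not> initial C A \<Longrightarrow> x \<in> UO A \<Longrightarrow>
           \<exists>B \<nu>. subobject C B \<nu> A \<and> indecomposable C B \<and> x \<in> UA \<nu> ` UO B"

end

theory Submission imports Defs begin

text \<open>
  A UD-category behaves like a category of sets in which coproducts are disjoint unions, glued along
  the points \<open>trivial_part A\<close> that an object \<open>A\<close> receives from the initial object. Monomorphisms are
  the injective morphisms (\<open>mono_arr_inj\<close>) and bijective morphisms are isomorphisms. Consequently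
  \<open>A\<close> is the coproduct of a family of subobjects as soon as they cover it and meet pairwise
  only in the trivial part (\<open>internal_coproduct\<close>), and binary coproducts always look like this.

  Indecomposable subobjects then behave like connected subsets. One that lies in a coproduct lies in
  a summand (\<open>indecomposable_in_summand\<close>), so a union of indecomposable subobjects through a common
  nontrivial point is indecomposable (\<open>union_indecomposable\<close>). Every nontrivial point lies in some
  indecomposable subobject, so every object is the coproduct of its connected components
  (\<open>decomposition\<close>).

  For a projective object it remains to see that the components are projective. There need
  not be a morphism from a complement back to the component, so a component need not be a retract.
  Instead a lifting problem for the component is extended by the identity of the complement; the lift
  cannot leave the part of the coproduct where it belongs (\<open>projective_summand\<close>). Conversely, lifts on
  the summands assemble to a lift on the coproduct (\<open>projective_coproduct\<close>).
\<close>

section \<open>Generalities on categories\<close>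

context category
begin

lemma HomD:
  assumes "f \<in> Hom C A B"
  shows "f \<in> Arr C" "Dom C f = A" "Cod C f = B" "A \<in> Obj C" "B \<in> Obj C"
  using assms Dom_Obj Cod_Obj by (auto simp: Hom_def)

lemma mono_arr_iff:
  assumes "f \<in> Hom C A B"
  shows "mono_arr C f \<longleftrightarrow>
    (\<forall>X. \<forall>g \<in> Hom C X A. \<forall>h \<in> Hom C X A. f \<cdot> g = f \<cdot> h \<longrightarrow> g = h)"
  using HomD[OF assms] by (simp add: mono_arr_def)

lemma epi_arr_iff:
  assumes "f \<in> Hom C A B"
  shows "epi_arr C f \<longleftrightarrow>
    (\<forall>X. \<forall>g \<in> Hom C B X. \<forall>h \<in> Hom C B X. g \<cdot> f = h \<cdot> f \<longrightarrow> g = h)"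
  using HomD[OF assms] by (simp add: epi_arr_def)

lemma iso_arr_iff:
  assumes "f \<in> Hom C A B"
  shows "iso_arr C f \<longleftrightarrow> (\<exists>g \<in> Hom C B A. g \<cdot> f = Id C A \<and> f \<cdot> g = Id C B)"
  using HomD[OF assms] by (simp add: iso_arr_def)

lemma isomorphicE:
  assumes "isomorphic C A B"
  obtains f g where "f \<in> Hom C A B" "g \<in> Hom C B A" "g \<cdot> f = Id C A" "f \<cdot> g = Id C B"
  using assms iso_arr_iff unfolding isomorphic_def by blast

lemma isomorphic_refl: "A \<in> Obj C \<Longrightarrow> isomorphic C A A"
  unfolding isomorphic_def using Id_Hom Comp_Id iso_arr_iff by blast

lemma mono_arr_left_factor:
  assumes f: "f \<in> Hom C A B" and g: "g \<in> Hom C B D" and m: "mono_arr C (g \<cdot> f)"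
  shows "mono_arr C f"
  unfolding mono_arr_iff[OF f]
proof (intro allI ballI impI)
  fix X h k assume h: "h \<in> Hom C X A" "k \<in> Hom C X A" "f \<cdot> h = f \<cdot> k"
  then have "(g \<cdot> f) \<cdot> h = (g \<cdot> f) \<cdot> k"
    using Comp_assoc[OF h(1) f g] Comp_assoc[OF h(2) f g] by simp
  then show "h = k" using m h mono_arr_iff[OF Comp_Hom[OF f g]] by blast
qed

lemma initial_isomorphic:
  assumes T: "initial C T" and iso: "isomorphic C T A"
  shows "initial C A"
proof -
  obtain f g where fg: "f \<in> Hom C T A" "g \<in> Hom C A T" "f \<cdot> g = Id C A"
    using iso by (elim isomorphicE)
  have "\<exists>!h. h \<in> Hom C A X" if "X \<in> Obj C" for X
  proof -
    have "\<exists>!t. t \<in> Hom C T X" using T that by (simp add: initial_def)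
    then obtain t where t: "t \<in> Hom C T X" "\<And>s. s \<in> Hom C T X \<Longrightarrow> s = t" by auto
    have "h = t \<cdot> g" if "h \<in> Hom C A X" for h
    proof -
      have "h = h \<cdot> (f \<cdot> g)" using Comp_Id[OF that] fg by simp
      also have "\<dots> = (h \<cdot> f) \<cdot> g" using Comp_assoc[OF fg(2) fg(1) that] by simp
      also have "\<dots> = t \<cdot> g" using t(2)[OF Comp_Hom[OF fg(1) that]] by simp
      finally show ?thesis .
    qed
    then show ?thesis using Comp_Hom[OF fg(2) t(1)] by blast
  qed
  then show ?thesis using HomD(5)[OF fg(1)] by (simp add: initial_def)
qed

lemma isomorphic_initial:
  assumes T: "initial C T" and iso: "isomorphic C A T"
  shows "initial C A"
proof -
  have "isomorphic C T A" 
    using isomorphicE[OF iso] iso_arr_iff unfolding isomorphic_def by metis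
  then show ?thesis using T initial_isomorphic by blast
qed

lemma is_coproductD:
  assumes "is_coproduct C I F Q \<nu>"
  shows "Q \<in> Obj C" "\<And>i. i \<in> I \<Longrightarrow> F i \<in> Obj C" "\<And>i. i \<in> I \<Longrightarrow> \<nu> i \<in> Hom C (F i) Q"
  using assms by (auto simp: is_coproduct_def)

lemma is_coproduct_ex1:
  assumes cp: "is_coproduct C I F Q \<nu>" and X: "X \<in> Obj C"
    and f: "\<And>i. i \<in> I \<Longrightarrow> f i \<in> Hom C (F i) X"
  shows "\<exists>!h. h \<in> Hom C Q X \<and> (\<forall>i\<in>I. h \<cdot> \<nu> i = f i)"
proof -
  have "\<forall>X \<in> Obj C. \<forall>f. (\<forall>i\<in>I. f i \<in> Hom C (F i) X) \<longrightarrow>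
      (\<exists>!h. h \<in> Hom C Q X \<and> (\<forall>i\<in>I. h \<cdot> \<nu> i = f i))"
    using cp by (simp add: is_coproduct_def)
  from this[rule_format, OF X f] show ?thesis .
qed

lemma is_coproduct_map:
  assumes "is_coproduct C I F Q \<nu>" "X \<in> Obj C" "\<And>i. i \<in> I \<Longrightarrow> f i \<in> Hom C (F i) X"
  obtains h where "h \<in> Hom C Q X" "\<And>i. i \<in> I \<Longrightarrow> h \<cdot> \<nu> i = f i"
  using is_coproduct_ex1[OF assms] by blast

lemma is_coproduct_eqI:
  assumes cp: "is_coproduct C I F Q \<nu>" and g: "g \<in> Hom C Q X" and h: "h \<in> Hom C Q X"
    and eq: "\<And>i. i \<in> I \<Longrightarrow> g \<cdot> \<nu> i = h \<cdot> \<nu> i"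
  shows "g = h"
proof -
  have "\<exists>!k. k \<in> Hom C Q X \<and> (\<forall>i\<in>I. k \<cdot> \<nu> i = h \<cdot> \<nu> i)"
    using is_coproduct_ex1[OF cp HomD(5)[OF g]] Comp_Hom[OF is_coproductD(3)[OF cp] h] by simp
  then show ?thesis using g h eq by metis
qed

lemma is_coproduct_iso:
  assumes cp: "is_coproduct C I F Q \<nu>"
    and f: "f \<in> Hom C Q R" and g: "g \<in> Hom C R Q"
    and gf: "g \<cdot> f = Id C Q" and fg: "f \<cdot> g = Id C R"
  shows "is_coproduct C I F R (\<lambda>i. f \<cdot> \<nu> i)"
  unfolding is_coproduct_def
proof (intro conjI ballI allI impI)
  note \<nu> = is_coproductD(3)[OF cp]
  show "R \<in> Obj C" using HomD f by blast
  show "F i \<in> Obj C" if "i \<in> I" for i using is_coproductD(2)[OF cp that] .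
  show "f \<cdot> \<nu> i \<in> Hom C (F i) R" if "i \<in> I" for i using Comp_Hom \<nu> f that by blast
  fix X k assume X: "X \<in> Obj C" and k: "\<forall>i\<in>I. k i \<in> Hom C (F i) X"
  obtain h where h: "h \<in> Hom C Q X" "\<And>i. i \<in> I \<Longrightarrow> h \<cdot> \<nu> i = k i"
    using is_coproduct_map[OF cp X] k by blast
  show "\<exists>!h. h \<in> Hom C R X \<and> (\<forall>i\<in>I. h \<cdot> (f \<cdot> \<nu> i) = k i)"
  proof (intro ex1I[of _ "h \<cdot> g"] conjI ballI)
    show "h \<cdot> g \<in> Hom C R X" using Comp_Hom g h by blast
    show "(h \<cdot> g) \<cdot> (f \<cdot> \<nu> i) = k i" if i: "i \<in> I" for i
    proof -
      have "(h \<cdot> g) \<cdot> (f \<cdot> \<nu> i) = h \<cdot> (g \<cdot> (f \<cdot> \<nu> i))"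
        using Comp_assoc Comp_Hom \<nu> f g h i by meson
      also have "g \<cdot> (f \<cdot> \<nu> i) = \<nu> i"
        using Comp_assoc[OF \<nu>[OF i] f g] gf Id_Comp[OF \<nu>[OF i]] by simp
      finally show ?thesis using h i by simp
    qed
    fix h' assume h': "h' \<in> Hom C R X \<and> (\<forall>i\<in>I. h' \<cdot> (f \<cdot> \<nu> i) = k i)"
    have "h' \<cdot> f = h"
    proof (rule is_coproduct_eqI[OF cp _ h(1)])
      show "h' \<cdot> f \<in> Hom C Q X" using Comp_Hom[OF f] h' by blast
      show "(h' \<cdot> f) \<cdot> \<nu> i = h \<cdot> \<nu> i" if "i \<in> I" for i
        using Comp_assoc[OF \<nu>[OF that] f] h' h(2)[OF that] that by metis
    qed
    then have "h \<cdot> g = h' \<cdot> (f \<cdot> g)" using Comp_assoc h' f g by metis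
    then show "h' = h \<cdot> g" using fg Comp_Id h' by metis
  qed
qed

lemma is_coproduct2_iff:
  "is_coproduct2 C A0 A1 Q \<nu>0 \<nu>1 \<longleftrightarrow>
     Q \<in> Obj C \<and> A0 \<in> Obj C \<and> A1 \<in> Obj C \<and> \<nu>0 \<in> Hom C A0 Q \<and> \<nu>1 \<in> Hom C A1 Q \<and>
     (\<forall>X \<in> Obj C. \<forall>f0 \<in> Hom C A0 X. \<forall>f1 \<in> Hom C A1 X.
        \<exists>!h. h \<in> Hom C Q X \<and> h \<cdot> \<nu>0 = f0 \<and> h \<cdot> \<nu>1 = f1)"
proof -
  have "(\<forall>f :: nat \<Rightarrow> _. f 0 \<in> Hom C A0 X \<and> f 1 \<in> Hom C A1 X \<longrightarrow>
          (\<exists>!h. h \<in> Hom C Q X \<and> h \<cdot> \<nu>0 = f 0 \<and> h \<cdot> \<nu>1 = f 1)) \<longleftrightarrow>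
        (\<forall>f0 \<in> Hom C A0 X. \<forall>f1 \<in> Hom C A1 X.
          \<exists>!h. h \<in> Hom C Q X \<and> h \<cdot> \<nu>0 = f0 \<and> h \<cdot> \<nu>1 = f1)" (is "?L \<longleftrightarrow> ?R") for X
  proof
    assume L: ?L
    show ?R
    proof (intro ballI)
      fix f0 f1 assume "f0 \<in> Hom C A0 X" "f1 \<in> Hom C A1 X"
      then show "\<exists>!h. h \<in> Hom C Q X \<and> h \<cdot> \<nu>0 = f0 \<and> h \<cdot> \<nu>1 = f1"
        using L[rule_format, of "pair_family f0 f1"] by simp
    qed
  qed simp
  then show ?thesis unfolding is_coproduct2_def is_coproduct_def by auto
qed

lemma is_coproduct_two_indices:
  assumes "is_coproduct C {a, b} F Q \<nu>" and ab: "a \<noteq> b"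
  shows "is_coproduct2 C (F a) (F b) Q (\<nu> a) (\<nu> b)"
  unfolding is_coproduct2_iff
proof (intro conjI ballI)
  fix X f0 f1 assume *: "X \<in> Obj C" "f0 \<in> Hom C (F a) X" "f1 \<in> Hom C (F b) X"
  let ?f = "\<lambda>i. if i = a then f0 else f1"
  have "?f i \<in> Hom C (F i) X" if "i \<in> {a, b}" for i using * ab that by auto
  from is_coproduct_ex1[OF assms(1) *(1) this]
  have "\<exists>!h. h \<in> Hom C Q X \<and> (\<forall>i\<in>{a, b}. h \<cdot> \<nu> i = ?f i)" by simp
  then show "\<exists>!h. h \<in> Hom C Q X \<and> h \<cdot> \<nu> a = f0 \<and> h \<cdot> \<nu> b = f1" using ab by simp
qed (use is_coproductD[OF assms(1)] in auto)

lemma projective_lift: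
  assumes "projective C P" "\<pi> \<in> Hom C A B" "epi_arr C \<pi>" "\<alpha> \<in> Hom C P B"
  obtains \<beta> where "\<beta> \<in> Hom C P A" "\<alpha> = \<pi> \<cdot> \<beta>"
  using assms unfolding projective_def by blast

lemma projective_coproduct:
  assumes cp: "is_coproduct C I F Q \<nu>" and proj: "\<And>i. i \<in> I \<Longrightarrow> projective C (F i)"
  shows "projective C Q"
  unfolding projective_def
proof (intro conjI allI ballI impI)
  show "Q \<in> Obj C" using is_coproductD(1)[OF cp] .
  fix A B \<pi> \<alpha> assume \<pi>: "\<pi> \<in> Hom C A B" "epi_arr C \<pi>" and \<alpha>: "\<alpha> \<in> Hom C Q B"
  note \<nu> = is_coproductD(3)[OF cp]
  have "\<exists>\<beta>. \<beta> \<in> Hom C (F i) A \<and> \<alpha> \<cdot> \<nu> i = \<pi> \<cdot> \<beta>" if "i \<in> I" for i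
    using projective_lift[OF proj[OF that] \<pi> Comp_Hom[OF \<nu>[OF that] \<alpha>]] by blast
  then obtain b where b: "\<And>i. i \<in> I \<Longrightarrow> b i \<in> Hom C (F i) A"
    "\<And>i. i \<in> I \<Longrightarrow> \<alpha> \<cdot> \<nu> i = \<pi> \<cdot> b i"
    by metis
  obtain \<beta> where \<beta>: "\<beta> \<in> Hom C Q A" "\<And>i. i \<in> I \<Longrightarrow> \<beta> \<cdot> \<nu> i = b i"
    using is_coproduct_map[OF cp HomD(4)[OF \<pi>(1)] b(1)] by metis
  have "\<alpha> = \<pi> \<cdot> \<beta>"
  proof (rule is_coproduct_eqI[OF cp \<alpha> Comp_Hom[OF \<beta>(1) \<pi>(1)]])
    fix i assume "i \<in> I"
    then show "\<alpha> \<cdot> \<nu> i = (\<pi> \<cdot> \<beta>) \<cdot> \<nu> i" using Comp_assoc[OF \<nu> \<beta>(1) \<pi>(1)] b \<beta> by simp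
  qed
  then show "\<exists>\<beta> \<in> Hom C Q A. \<alpha> = \<pi> \<cdot> \<beta>" using \<beta> by blast
qed

lemma projective_isomorphic:
  assumes Q: "projective C Q" and iso: "isomorphic C P Q"
  shows "projective C P"
  unfolding projective_def
proof (intro conjI allI ballI impI)
  obtain f g where f: "f \<in> Hom C P Q" and g: "g \<in> Hom C Q P" and gf: "g \<cdot> f = Id C P"
    using iso by (elim isomorphicE)
  show "P \<in> Obj C" using HomD f by blast
  fix A B \<pi> \<alpha> assume \<pi>: "\<pi> \<in> Hom C A B" "epi_arr C \<pi>" and \<alpha>: "\<alpha> \<in> Hom C P B"
  obtain \<beta> where \<beta>: "\<beta> \<in> Hom C Q A" "\<alpha> \<cdot> g = \<pi> \<cdot> \<beta>"
    using projective_lift[OF Q \<pi> Comp_Hom[OF g \<alpha>]] by blast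
  have "\<alpha> = \<alpha> \<cdot> (g \<cdot> f)" using gf Comp_Id \<alpha> by simp
  also have "\<dots> = (\<alpha> \<cdot> g) \<cdot> f" using Comp_assoc[OF f g \<alpha>] by simp
  also have "\<dots> = \<pi> \<cdot> (\<beta> \<cdot> f)" using Comp_assoc[OF f \<beta>(1) \<pi>(1)] \<beta>(2) by simp
  finally show "\<exists>\<beta> \<in> Hom C P A. \<alpha> = \<pi> \<cdot> \<beta>" using Comp_Hom f \<beta> by blast
qed

end

section \<open>Morphisms of a UD-category and the trivial part of an object\<close>

context UD_category
begin

lemma UA_mem: "f \<in> Hom C A B \<Longrightarrow> x \<in> UO A \<Longrightarrow> UA f x \<in> UO B"
  using UA_funcset by blast

lemma UA_image_Comp:
  "f \<in> Hom C A B \<Longrightarrow> g \<in> Hom C B D \<Longrightarrow> UA (g \<cdot> f) ` UO A = UA g ` UA f ` UO A"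
  by (auto simp: UA_Comp image_image)

lemma mono_arr_if_inj:
  assumes f: "f \<in> Hom C A B" and inj: "inj_on (UA f) (UO A)"
  shows "mono_arr C f"
  unfolding mono_arr_iff[OF f]
proof (intro allI ballI impI)
  fix X g h assume g: "g \<in> Hom C X A" and h: "h \<in> Hom C X A" and eq: "f \<cdot> g = f \<cdot> h"
  show "g = h"
  proof (rule UA_faithful[OF g h])
    fix x assume x: "x \<in> UO X"
    then have "UA f (UA g x) = UA f (UA h x)" using UA_Comp[OF g f] UA_Comp[OF h f] eq by metis
    then show "UA g x = UA h x" using inj x UA_mem g h by (meson inj_onD)
  qed
qed

lemma epi_arr_if_surj:
  assumes f: "f \<in> Hom C A B" and surj: "UO B \<subseteq> UA f ` UO A"
  shows "epi_arr C f"
  unfolding epi_arr_iff[OF f]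
proof (intro allI ballI impI)
  fix X g h assume g: "g \<in> Hom C B X" and h: "h \<in> Hom C B X" and eq: "g \<cdot> f = h \<cdot> f"
  show "g = h"
  proof (rule UA_faithful[OF g h])
    fix y assume "y \<in> UO B"
    then obtain x where x: "x \<in> UO A" "y = UA f x" using surj by blast
    then show "UA g y = UA h y" using UA_Comp[OF f g] UA_Comp[OF f h] eq by metis
  qed
qed

lemma inverse_UA:
  assumes "f \<in> Hom C A B" "g \<in> Hom C B A" "g \<cdot> f = Id C A" "x \<in> UO A"
  shows "UA g (UA f x) = x"
  using assms UA_Comp UA_Id HomD(4) by metis

lemma iso_arr_inj:
  assumes f: "f \<in> Hom C A B" and iso: "iso_arr C f"
  shows "inj_on (UA f) (UO A)"
proof -
  obtain g where g: "g \<in> Hom C B A" "g \<cdot> f = Id C A"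
    using iso iso_arr_iff[OF f] by blast
  show ?thesis using inverse_UA[OF f g] by (rule inj_on_inverseI)
qed

lemma iso_arr_if_bij:
  assumes "f \<in> Hom C A B" "inj_on (UA f) (UO A)" "UO B \<subseteq> UA f ` UO A"
  shows "iso_arr C f"
  using assms mono_arr_if_inj epi_arr_if_surj UD1_balanced unfolding balanced_def by blast

text \<open>
  A morphism is onto its image, so it factors as an epimorphism followed by an inclusion. If it is a
  monomorphism, then so is the first factor, which balancedness turns into an isomorphism.
\<close>
lemma mono_arr_inj:
  assumes f: "f \<in> Hom C A B" and m: "mono_arr C f"
  shows "inj_on (UA f) (UO A)"
proof -
  obtain S \<iota> where S: "subobject C S \<iota> B" "UO S = UA f ` UO A" "\<And>x. x \<in> UO S \<Longrightarrow> UA \<iota> x = x"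
    using UD2[OF f] unfolding inclusion_subobject_def by blast
  then have \<iota>: "\<iota> \<in> Hom C S B" by (simp add: subobject_def)
  obtain g where g: "g \<in> Hom C A S" "f = \<iota> \<cdot> g" using UD3[OF f S(1)] S by force
  have val: "UA f x = UA g x" if "x \<in> UO A" for x
    using g UA_Comp[OF g(1) \<iota> that] S(3) UA_mem[OF g(1) that] by simp
  have "epi_arr C g" using val S(2) by (intro epi_arr_if_surj[OF g(1)]) auto
  moreover have "mono_arr C g" using mono_arr_left_factor[OF g(1) \<iota>] m g by simp
  ultimately have "iso_arr C g" using UD1_balanced by (simp add: balanced_def)
  then have "inj_on (UA g) (UO A)" using iso_arr_inj g by blast
  then show ?thesis using val by (simp add: inj_on_def)
qed

lemma subobjectD:
  assumes "subobject C S \<nu> A"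
  shows "\<nu> \<in> Hom C S A" "mono_arr C \<nu>" "inj_on (UA \<nu>) (UO S)" "S \<in> Obj C" "A \<in> Obj C"
  using assms mono_arr_inj HomD unfolding subobject_def by blast+

lemma subobject_factor:
  assumes S: "subobject C S \<mu> A" and T: "subobject C T \<nu> A"
    and sub: "UA \<mu> ` UO S \<subseteq> UA \<nu> ` UO T"
  obtains \<kappa> where "subobject C S \<kappa> T" "\<mu> = \<nu> \<cdot> \<kappa>"
proof -
  obtain \<kappa> where \<kappa>: "\<kappa> \<in> Hom C S T" "\<mu> = \<nu> \<cdot> \<kappa>"
    using UD3[OF subobjectD(1)[OF S] T sub] by blast
  have "mono_arr C (\<nu> \<cdot> \<kappa>)" using subobjectD(2)[OF S] \<kappa>(2) by metis
  then have "mono_arr C \<kappa>" using mono_arr_left_factor[OF \<kappa>(1) subobjectD(1)[OF T]] by blast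
  then show thesis using that \<kappa> unfolding subobject_def by blast
qed

definition zero :: 'o where
  "zero = (SOME T. initial C T)"

definition zero_arr :: "'o \<Rightarrow> 'm" where
  "zero_arr A = (THE f. f \<in> Hom C zero A)"

text \<open>
  The underlying set of an initial object may be nonempty (for pointed sets it is the base point).
  Every subobject of \<open>A\<close> contains the image of this set in \<open>A\<close>, so two subobjects can be
  disjoint only outside this image.
\<close>
definition trivial_part :: "'o \<Rightarrow> 'e set" where
  "trivial_part A = UA (zero_arr A) ` UO zero"

lemma initial_zero: "initial C zero"
  unfolding zero_def using UD1_initial by (metis someI_ex)

lemma zero_arr_Hom: "A \<in> Obj C \<Longrightarrow> zero_arr A \<in> Hom C zero A"
  unfolding zero_arr_def using initial_zero theI'[of "\<lambda>f. f \<in> Hom C zero A"]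
  by (simp add: initial_def)

lemma zero_arr_unique: "f \<in> Hom C zero A \<Longrightarrow> f = zero_arr A"
  using initial_zero zero_arr_Hom HomD(5) unfolding initial_def by metis

lemma zero_subobject: "A \<in> Obj C \<Longrightarrow> subobject C zero (zero_arr A) A"
  using UD1_from_initial[OF initial_zero] zero_arr_Hom by (simp add: subobject_def)

lemma Comp_zero_arr: "f \<in> Hom C A B \<Longrightarrow> f \<cdot> zero_arr A = zero_arr B"
  using zero_arr_unique Comp_Hom zero_arr_Hom HomD(4) by blast

lemma trivial_part_subset: "A \<in> Obj C \<Longrightarrow> trivial_part A \<subseteq> UO A"
  unfolding trivial_part_def using zero_arr_Hom UA_mem by blast

lemma UA_zero_arr:
  "f \<in> Hom C A B \<Longrightarrow> z \<in> UO zero \<Longrightarrow> UA f (UA (zero_arr A) z) = UA (zero_arr B) z"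
  using UA_Comp[OF zero_arr_Hom] Comp_zero_arr HomD(4) by metis

lemma UA_trivial_part: "f \<in> Hom C A B \<Longrightarrow> UA f ` trivial_part A = trivial_part B"
  unfolding trivial_part_def by (auto simp: UA_zero_arr image_image)

lemma trivial_part_image: "f \<in> Hom C A B \<Longrightarrow> trivial_part B \<subseteq> UA f ` UO A"
  using UA_trivial_part trivial_part_subset HomD(4) by (metis image_mono)

lemma trivial_part_subobject:
  assumes \<nu>: "subobject C S \<nu> A" and x: "x \<in> UO S" "UA \<nu> x \<in> trivial_part A"
  shows "x \<in> trivial_part S"
proof -
  note \<nu>' = subobjectD[OF \<nu>]
  obtain y where "y \<in> trivial_part S" "UA \<nu> y = UA \<nu> x"
    using x UA_trivial_part[OF \<nu>'(1)] by (metis imageE)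
  then show ?thesis
    using \<nu>'(3) x trivial_part_subset[OF \<nu>'(4)] by (metis inj_onD subsetD)
qed

lemma initial_iff_trivial:
  assumes A: "A \<in> Obj C"
  shows "initial C A \<longleftrightarrow> UO A \<subseteq> trivial_part A"
proof
  note z = zero_arr_Hom[OF A]
  assume i: "initial C A"
  then obtain g where g: "g \<in> Hom C A zero"
    using HomD(4)[OF z] unfolding initial_def by blast
  have "zero_arr A \<cdot> g = Id C A"
    using i Comp_Hom[OF g z] Id_Hom A unfolding initial_def by blast
  then have "x \<in> trivial_part A" if "x \<in> UO A" for x
    using inverse_UA[OF g z _ that] UA_mem[OF g that] unfolding trivial_part_def by force
  then show "UO A \<subseteq> trivial_part A" by blast
next
  note z = zero_subobject[OF A]
  assume "UO A \<subseteq> trivial_part A"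
  then have "iso_arr C (zero_arr A)"
    using iso_arr_if_bij subobjectD[OF z] by (simp add: trivial_part_def)
  then have "isomorphic C zero A" using zero_arr_Hom[OF A] unfolding isomorphic_def by blast
  then show "initial C A" using initial_isomorphic initial_zero by blast
qed

text \<open>Two small indices turn statements about small families into statements about pairs.\<close>
lemma two_small_indices:
  obtains a b :: 'e where "a \<noteq> b" "small {a, b}"
proof -
  obtain X :: "'e set" where X: "small X" "infinite X" using small_infinite by blast
  obtain a where a: "a \<in> X" using X(2) by fastforce
  have "infinite (X - {a})" using X(2) by simp
  then have "X - {a} \<noteq> {}" by (metis finite.emptyI)
  then obtain b where "b \<in> X - {a}" by blast
  then show thesis using that[of a b] small_subset[OF X(1), of "{a, b}"] a by auto
qed

lemma union_subobject:
  fixes I :: "'e set"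
  assumes A: "A \<in> Obj C" and I: "small I" and S: "\<And>i. i \<in> I \<Longrightarrow> subobject C (F i) (\<mu> i) A"
  obtains D \<iota> where "subobject C D \<iota> A"
    "UA \<iota> ` UO D = trivial_part A \<union> (\<Union>i\<in>I. UA (\<mu> i) ` UO (F i))"
proof (cases "I = {}")
  case True
  then show thesis using that zero_subobject[OF A] by (simp add: trivial_part_def)
next
  case False
  obtain D \<iota> where D: "is_union I F \<mu> A D \<iota>" using UD4[OF A I False, of F \<mu>] S by blast
  then have *: "subobject C D \<iota> A" "UA \<iota> ` UO D = (\<Union>i\<in>I. UA (\<mu> i) ` UO (F i))"
    unfolding is_union_def inclusion_subobject_def by auto
  moreover have "trivial_part A \<subseteq> UA \<iota> ` UO D"
    using trivial_part_image subobjectD(1) * by blast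
  ultimately show thesis using that by (simp add: Un_absorb1)
qed

lemma intersection_subobject:
  assumes S: "subobject C S \<mu> A" and T: "subobject C T \<nu> A"
  obtains D \<iota> where "is_intersection {0, 1} (pair_family S T) (pair_family \<mu> \<nu>) A D \<iota>"
    "subobject C D \<iota> A" "UA \<iota> ` UO D = UA \<mu> ` UO S \<inter> UA \<nu> ` UO T"
proof -
  obtain a b :: 'e where ab: "a \<noteq> b" "small {a, b}" by (rule two_small_indices)
  let ?F = "\<lambda>i. if i = a then S else T" and ?\<mu> = "\<lambda>i. if i = a then \<mu> else \<nu>"
  have "\<exists>D \<iota>. is_intersection {a, b} ?F ?\<mu> A D \<iota>"
    using UD4[OF subobjectD(5)[OF S] ab(2), of ?F ?\<mu>] S T by auto
  then obtain D \<iota> where "is_intersection {a, b} ?F ?\<mu> A D \<iota>" by blast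
  then have *: "inclusion_subobject D \<iota> A" "UO D = UA \<mu> ` UO S \<inter> UA \<nu> ` UO T"
    using ab unfolding is_intersection_def by auto
  moreover from this have "UA \<iota> ` UO D = UO D" by (auto simp: inclusion_subobject_def)
  ultimately show thesis
    by (intro that[of D \<iota>]) (auto simp: is_intersection_def inclusion_subobject_def)
qed

section \<open>Coproducts as disjoint unions over the trivial part\<close>

text \<open>
  All coprojections factor through the union \<open>D\<close> of their images. The induced morphism from the
  coproduct to \<open>D\<close> is a section of the inclusion of \<open>D\<close>, so the inclusion is onto.
\<close>
lemma coproduct_cover:
  fixes I :: "'e set"
  assumes I: "small I" and cp: "is_coproduct C I F Q \<nu>"
  shows "UO Q = trivial_part Q \<union> (\<Union>i\<in>I. UA (\<nu> i) ` UO (F i))"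
proof -
  note \<nu> = is_coproductD(3)[OF cp] and Q = is_coproductD(1)[OF cp]
  \<comment> \<open>The coprojections are not yet known to be monic, so their images are used.\<close>
  have "\<forall>i\<in>I. \<exists>S \<iota>. subobject C S \<iota> Q \<and> UA \<iota> ` UO S = UA (\<nu> i) ` UO (F i)"
    using UD2[OF \<nu>] unfolding inclusion_subobject_def by (metis image_cong image_ident)
  then obtain S \<iota> where S: "\<And>i. i \<in> I \<Longrightarrow> subobject C (S i) (\<iota> i) Q"
    "\<And>i. i \<in> I \<Longrightarrow> UA (\<iota> i) ` UO (S i) = UA (\<nu> i) ` UO (F i)"
    by metis
  obtain D \<delta> where D: "subobject C D \<delta> Q"
    "UA \<delta> ` UO D = trivial_part Q \<union> (\<Union>i\<in>I. UA (\<iota> i) ` UO (S i))"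
    using union_subobject[OF Q I, of S \<iota>] S(1) by blast
  note \<delta> = subobjectD(1)[OF D(1)]
  have D_image: "UA \<delta> ` UO D = trivial_part Q \<union> (\<Union>i\<in>I. UA (\<nu> i) ` UO (F i))"
    using D(2) S(2) by simp
  have "\<exists>g \<in> Hom C (F i) D. \<nu> i = \<delta> \<cdot> g" if "i \<in> I" for i
  proof (rule UD3[OF \<nu>[OF that] D(1)])
    show "UA (\<nu> i) ` UO (F i) \<subseteq> UA \<delta> ` UO D" unfolding D_image using that by auto
  qed
  then obtain g where g: "\<And>i. i \<in> I \<Longrightarrow> g i \<in> Hom C (F i) D" "\<And>i. i \<in> I \<Longrightarrow> \<nu> i = \<delta> \<cdot> g i"
    by metis
  obtain h where h: "h \<in> Hom C Q D" "\<And>i. i \<in> I \<Longrightarrow> h \<cdot> \<nu> i = g i"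
    using is_coproduct_map[OF cp HomD(4)[OF \<delta>] g(1)] by metis
  have "\<delta> \<cdot> h = Id C Q"
  proof (rule is_coproduct_eqI[OF cp Comp_Hom[OF h(1) \<delta>] Id_Hom[OF Q]])
    fix i assume i: "i \<in> I"
    show "(\<delta> \<cdot> h) \<cdot> \<nu> i = Id C Q \<cdot> \<nu> i"
      using Comp_assoc[OF \<nu>[OF i] h(1) \<delta>] h(2)[OF i] g(2)[OF i] Id_Comp[OF \<nu>[OF i]] by simp
  qed
  then have "UO Q \<subseteq> UA \<delta> ` UO D"
    using inverse_UA[OF h(1) \<delta>] UA_mem[OF h(1)] by (metis image_eqI subsetI)
  moreover have "UA \<delta> ` UO D \<subseteq> UO Q" using UA_mem[OF \<delta>] by auto
  ultimately show ?thesis using D_image by (metis subset_antisym)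
qed

text \<open>
  The comparison morphism from an external coproduct is onto because the parts cover, and one-to-one
  because each part embeds and two parts meet only in points coming from the initial object, which the
  coproduct has identified already.
\<close>
lemma internal_coproduct:
  fixes I :: "'e set"
  assumes A: "A \<in> Obj C" and I: "small I" and S: "\<And>i. i \<in> I \<Longrightarrow> subobject C (F i) (\<mu> i) A"
    and cover: "UO A \<subseteq> trivial_part A \<union> (\<Union>i\<in>I. UA (\<mu> i) ` UO (F i))"
    and disj: "\<And>i j. i \<in> I \<Longrightarrow> j \<in> I \<Longrightarrow> i \<noteq> j \<Longrightarrow>
      UA (\<mu> i) ` UO (F i) \<inter> UA (\<mu> j) ` UO (F j) \<subseteq> trivial_part A"
  shows "is_coproduct C I F A \<mu>"
proof -
  have "\<forall>i\<in>I. F i \<in> Obj C" using subobjectD(4)[OF S] by blast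
  then obtain Q \<nu> where cp: "is_coproduct C I F Q \<nu>"
    using UD1_coproducts I unfolding coproduct_complete_def by blast
  note \<nu> = is_coproductD(3)[OF cp]
  have \<mu>: "\<mu> i \<in> Hom C (F i) A" if "i \<in> I" for i using subobjectD(1)[OF S[OF that]] .
  obtain h where h: "h \<in> Hom C Q A" "\<And>i. i \<in> I \<Longrightarrow> h \<cdot> \<nu> i = \<mu> i"
    using is_coproduct_map[OF cp A \<mu>] by metis
  have h\<nu>: "UA h (UA (\<nu> i) x) = UA (\<mu> i) x" if "i \<in> I" "x \<in> UO (F i)" for i x
    using UA_Comp[OF \<nu>[OF that(1)] h(1) that(2)] h(2)[OF that(1)] by simp
  have Qcov: "UO Q = trivial_part Q \<union> (\<Union>i\<in>I. UA (\<nu> i) ` UO (F i))"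
    using coproduct_cover[OF I cp] .
  have inj_triv: "y = y'" if "y \<in> trivial_part Q" "y' \<in> trivial_part Q" "UA h y = UA h y'" for y y'
    using that UA_zero_arr[OF h(1)] subobjectD(3)[OF zero_subobject[OF A]]
    unfolding trivial_part_def inj_on_def by fastforce
  have triv: "y \<in> trivial_part Q" if y: "y \<in> UO Q" "UA h y \<in> trivial_part A" for y
  proof -
    consider "y \<in> trivial_part Q" | i x where "i \<in> I" "x \<in> UO (F i)" "y = UA (\<nu> i) x"
      using y(1) Qcov by blast
    then show ?thesis
    proof cases
      case 2
      then have "UA (\<mu> i) x \<in> trivial_part A" using h\<nu> y(2) by simp
      then have "x \<in> trivial_part (F i)" using trivial_part_subobject[OF S] 2 by blast
      then show ?thesis using UA_trivial_part[OF \<nu>] 2 by blast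
    qed
  qed
  have "inj_on (UA h) (UO Q)"
  proof (rule inj_onI)
    fix y y' assume y: "y \<in> UO Q" "y' \<in> UO Q" "UA h y = UA h y'"
    show "y = y'"
    proof (cases "UA h y \<in> trivial_part A")
      case True
      then show ?thesis using triv inj_triv y by metis
    next
      case False
      then have "y \<notin> trivial_part Q" "y' \<notin> trivial_part Q"
        using UA_trivial_part[OF h(1)] y(3) by (metis imageI)+
      then obtain i x j x' where ij: "i \<in> I" "x \<in> UO (F i)" "y = UA (\<nu> i) x"
        "j \<in> I" "x' \<in> UO (F j)" "y' = UA (\<nu> j) x'"
        using Qcov y by blast
      have eq: "UA (\<mu> i) x = UA (\<mu> j) x'" "UA (\<mu> i) x \<notin> trivial_part A"
        using h\<nu> ij y(3) False by auto
      have "i = j"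
      proof (rule ccontr)
        assume "i \<noteq> j"
        moreover have "UA (\<mu> i) x \<in> UA (\<mu> i) ` UO (F i)" using ij(2) by (rule imageI)
        moreover have "UA (\<mu> i) x \<in> UA (\<mu> j) ` UO (F j)" unfolding eq(1) using ij(5) by (rule imageI)
        ultimately show False using disj[OF ij(1,4)] eq(2) by (meson IntI subsetD)
      qed
      then show ?thesis using eq ij subobjectD(3)[OF S] by (metis inj_onD)
    qed
  qed
  moreover have "UO A \<subseteq> UA h ` UO Q"
  proof
    fix y assume "y \<in> UO A"
    then consider "y \<in> trivial_part A" | i x where "i \<in> I" "x \<in> UO (F i)" "y = UA (\<mu> i) x"
      using cover by blast
    then show "y \<in> UA h ` UO Q"
    proof cases
      case 1
      then show ?thesis using trivial_part_image[OF h(1)] by blast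
    next
      case 2
      then show ?thesis using h\<nu>[OF 2(1,2)] UA_mem[OF \<nu>[OF 2(1)] 2(2)] by force
    qed
  qed
  ultimately have "iso_arr C h" using iso_arr_if_bij[OF h(1)] by blast
  then obtain k where k: "k \<in> Hom C A Q" "k \<cdot> h = Id C Q" "h \<cdot> k = Id C A"
    using iso_arr_iff[OF h(1)] by blast
  have "is_coproduct C I F A (\<lambda>i. h \<cdot> \<nu> i)"
    using is_coproduct_iso[OF cp h(1) k] .
  then show ?thesis using h(2) by (simp add: is_coproduct_def)
qed

lemma internal_coproduct2:
  assumes S: "subobject C S \<mu> A" and T: "subobject C T \<nu> A"
    and cover: "UO A \<subseteq> UA \<mu> ` UO S \<union> UA \<nu> ` UO T"
    and disj: "UA \<mu> ` UO S \<inter> UA \<nu> ` UO T \<subseteq> trivial_part A"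
  shows "is_coproduct2 C S T A \<mu> \<nu>"
proof -
  obtain a b :: 'e where ab: "a \<noteq> b" "small {a, b}" by (rule two_small_indices)
  let ?F = "\<lambda>i. if i = a then S else T" and ?\<mu> = "\<lambda>i. if i = a then \<mu> else \<nu>"
  have "is_coproduct C {a, b} ?F A ?\<mu>"
    using ab S T cover disj by (intro internal_coproduct[OF subobjectD(5)[OF S]]) auto
  from is_coproduct_two_indices[OF this ab(1)] show ?thesis using ab(1) by simp
qed

lemma coproduct2_exists:
  assumes "A \<in> Obj C" "B \<in> Obj C"
  obtains Q \<nu>0 \<nu>1 where "is_coproduct2 C A B Q \<nu>0 \<nu>1"
proof -
  obtain a b :: 'e where ab: "a \<noteq> b" "small {a, b}" by (rule two_small_indices)
  let ?F = "\<lambda>i. if i = a then A else B"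
  have "\<forall>i\<in>{a, b}. ?F i \<in> Obj C" using assms by simp
  then obtain Q \<nu> where "is_coproduct C {a, b} ?F Q \<nu>"
    using UD1_coproducts ab(2) unfolding coproduct_complete_def by presburger
  from is_coproduct_two_indices[OF this ab(1)] show thesis using ab(1) that by simp
qed

lemma coproduct2_subobjects:
  assumes "is_coproduct2 C A0 A1 Q \<nu>0 \<nu>1"
  shows "subobject C A0 \<nu>0 Q" "subobject C A1 \<nu>1 Q"
  using assms UD5[OF assms] unfolding is_coproduct2_iff subobject_def by blast+

lemma coproduct2_disjoint:
  assumes cp: "is_coproduct2 C A0 A1 Q \<nu>0 \<nu>1"
  shows "UA \<nu>0 ` UO A0 \<inter> UA \<nu>1 ` UO A1 \<subseteq> trivial_part Q"
proof -
  obtain D \<iota> where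
    D: "is_intersection {0, 1} (pair_family A0 A1) (pair_family \<nu>0 \<nu>1) Q D \<iota>"
       "subobject C D \<iota> Q" "UA \<iota> ` UO D = UA \<nu>0 ` UO A0 \<inter> UA \<nu>1 ` UO A1"
    using intersection_subobject[OF coproduct2_subobjects[OF cp]] by metis
  have "isomorphic C D zero" using UD5[OF cp] D(1) initial_zero by blast
  then have "UO D \<subseteq> trivial_part D"
    using initial_zero isomorphic_initial initial_iff_trivial subobjectD(4)[OF D(2)] by blast
  then show ?thesis using D(3) UA_trivial_part[OF subobjectD(1)[OF D(2)]] by blast
qed

lemma coproduct2_cover:
  assumes cp: "is_coproduct2 C A0 A1 Q \<nu>0 \<nu>1"
  shows "UO Q \<subseteq> UA \<nu>0 ` UO A0 \<union> UA \<nu>1 ` UO A1"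
proof -
  obtain a b :: 'e where ab: "a \<noteq> b" "small {a, b}" by (rule two_small_indices)
  let ?F = "\<lambda>i. if i = a then A0 else A1" and ?\<nu> = "\<lambda>i. if i = a then \<nu>0 else \<nu>1"
  have "is_coproduct C {a, b} ?F Q ?\<nu>"
    unfolding is_coproduct_def
  proof (intro conjI ballI allI impI)
    fix X f assume "X \<in> Obj C" "\<forall>i\<in>{a, b}. f i \<in> Hom C (?F i) X"
    then have "f a \<in> Hom C A0 X" "f b \<in> Hom C A1 X" "X \<in> Obj C" using ab(1) by auto
    then have "\<exists>!h. h \<in> Hom C Q X \<and> h \<cdot> \<nu>0 = f a \<and> h \<cdot> \<nu>1 = f b"
      using cp unfolding is_coproduct2_iff by blast
    then show "\<exists>!h. h \<in> Hom C Q X \<and> (\<forall>i\<in>{a, b}. h \<cdot> ?\<nu> i = f i)" using ab(1) by simp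
  qed (use cp in \<open>auto simp: is_coproduct2_iff split: if_splits\<close>)
  then have "UO Q = trivial_part Q \<union> (\<Union>i\<in>{a, b}. UA (?\<nu> i) ` UO (?F i))"
    by (rule coproduct_cover[OF ab(2)])
  moreover have "trivial_part Q \<subseteq> UA \<nu>0 ` UO A0"
    using trivial_part_image subobjectD(1) coproduct2_subobjects[OF cp] by blast
  ultimately show ?thesis using ab(1) by auto
qed

section \<open>Decomposition into indecomposable objects\<close>

text \<open>
  The traces of a binary coproduct on a subobject exhibit that subobject as a coproduct. If it is
  indecomposable, one of the traces is initial, hence adds nothing to the other.
\<close>
lemma indecomposable_in_summand:
  assumes cp: "is_coproduct2 C A0 A1 Q \<nu>0 \<nu>1" and B: "indecomposable C B" "subobject C B \<phi> Q"
  shows "UA \<phi> ` UO B \<subseteq> UA \<nu>0 ` UO A0 \<or> UA \<phi> ` UO B \<subseteq> UA \<nu>1 ` UO A1"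
proof -
  note \<phi> = subobjectD[OF B(2)] and sub = coproduct2_subobjects[OF cp]
  have trace: "\<exists>E \<epsilon>. subobject C E \<epsilon> B \<and> UA \<phi> ` UA \<epsilon> ` UO E = UA \<phi> ` UO B \<inter> UA \<nu> ` UO A"
    if A: "subobject C A \<nu> Q" for A \<nu>
  proof -
    obtain E \<iota> where E: "subobject C E \<iota> Q" "UA \<iota> ` UO E = UA \<phi> ` UO B \<inter> UA \<nu> ` UO A"
      using intersection_subobject[OF B(2) A] by metis
    obtain \<epsilon> where \<epsilon>: "subobject C E \<epsilon> B" "\<iota> = \<phi> \<cdot> \<epsilon>"
      using subobject_factor[OF E(1) B(2)] E(2) by blast
    then show ?thesis using UA_image_Comp[OF subobjectD(1)[OF \<epsilon>(1)] \<phi>(1)] E(2) by metis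
  qed
  obtain E0 \<epsilon>0 where E0: "subobject C E0 \<epsilon>0 B"
    "UA \<phi> ` UA \<epsilon>0 ` UO E0 = UA \<phi> ` UO B \<inter> UA \<nu>0 ` UO A0"
    using trace[OF sub(1)] by blast
  obtain E1 \<epsilon>1 where E1: "subobject C E1 \<epsilon>1 B"
    "UA \<phi> ` UA \<epsilon>1 ` UO E1 = UA \<phi> ` UO B \<inter> UA \<nu>1 ` UO A1"
    using trace[OF sub(2)] by blast
  have sub0: "UA \<epsilon>0 ` UO E0 \<subseteq> UO B" and sub1: "UA \<epsilon>1 ` UO E1 \<subseteq> UO B"
    using UA_mem subobjectD(1) E0(1) E1(1) by blast+
  have "is_coproduct2 C E0 E1 B \<epsilon>0 \<epsilon>1"
  proof (rule internal_coproduct2[OF E0(1) E1(1)])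
    show "UO B \<subseteq> UA \<epsilon>0 ` UO E0 \<union> UA \<epsilon>1 ` UO E1"
    proof
      fix x assume x: "x \<in> UO B"
      then have "UA \<phi> x \<in> UA \<nu>0 ` UO A0 \<union> UA \<nu>1 ` UO A1"
        using coproduct2_cover[OF cp] UA_mem[OF \<phi>(1)] by blast
      then have "UA \<phi> x \<in> UA \<phi> ` (UA \<epsilon>0 ` UO E0 \<union> UA \<epsilon>1 ` UO E1)"
        unfolding image_Un E0(2) E1(2) using x by simp
      then show "x \<in> UA \<epsilon>0 ` UO E0 \<union> UA \<epsilon>1 ` UO E1"
        using inj_on_image_mem_iff[OF \<phi>(3) x] sub0 sub1 by blast
    qed
    show "UA \<epsilon>0 ` UO E0 \<inter> UA \<epsilon>1 ` UO E1 \<subseteq> trivial_part B"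
    proof
      fix x assume x: "x \<in> UA \<epsilon>0 ` UO E0 \<inter> UA \<epsilon>1 ` UO E1"
      then have "UA \<phi> x \<in> UA \<nu>0 ` UO A0 \<inter> UA \<nu>1 ` UO A1" using E0(2) E1(2) by blast
      then have "UA \<phi> x \<in> trivial_part Q" using coproduct2_disjoint[OF cp] by blast
      then show "x \<in> trivial_part B" using trivial_part_subobject[OF B(2)] x sub0 by blast
    qed
  qed
  then have "initial C E0 \<or> initial C E1"
    using B(1) isomorphic_refl[of B] subobjectD(4) E0(1) E1(1)
    unfolding indecomposable_def by blast
  moreover have "UA \<phi> ` UO B \<subseteq> UA \<nu>' ` UO A'"
    if E: "subobject C E \<epsilon> B" "UA \<phi> ` UA \<epsilon> ` UO E = UA \<phi> ` UO B \<inter> UA \<nu> ` UO A" "initial C E"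
      and A': "subobject C A' \<nu>' Q" and cov: "UO Q \<subseteq> UA \<nu> ` UO A \<union> UA \<nu>' ` UO A'"
    for E \<epsilon> A \<nu> A' \<nu>'
  proof -
    have "UO E \<subseteq> trivial_part E"
      using E(3) initial_iff_trivial subobjectD(4)[OF E(1)] by blast
    then have "UA \<phi> ` UA \<epsilon> ` UO E \<subseteq> trivial_part Q"
      using UA_trivial_part[OF \<phi>(1)] UA_trivial_part[OF subobjectD(1)[OF E(1)]] by blast
    moreover have "trivial_part Q \<subseteq> UA \<nu>' ` UO A'"
      using trivial_part_image[OF subobjectD(1)[OF A']] .
    moreover have "UA \<phi> ` UO B \<subseteq> UO Q" using UA_mem[OF \<phi>(1)] by blast
    ultimately have "UA \<phi> ` UO B \<inter> UA \<nu> ` UO A \<subseteq> UA \<nu>' ` UO A'"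
      and "UA \<phi> ` UO B \<subseteq> UA \<nu> ` UO A \<union> UA \<nu>' ` UO A'"
      using E(2) cov by (metis order_trans)+
    then show ?thesis by (metis Int_Un_distrib Un_least inf.absorb_iff1 inf_le2)
  qed
  ultimately show ?thesis
    using coproduct2_cover[OF cp] sub E0 E1 by (metis Un_commute)
qed

text \<open>
  This is the analogue of the fact that a union of connected sets through a common point is connected:
  every member of the family lies in one of the two summands, and it has to be the summand that
  contains the common point.
\<close>
lemma union_indecomposable:
  fixes I :: "'e set"
  assumes I: "I \<noteq> {}"
    and S: "\<And>i. i \<in> I \<Longrightarrow> subobject C (F i) (\<mu> i) A" "\<And>i. i \<in> I \<Longrightarrow> indecomposable C (F i)"
    and x: "x \<notin> trivial_part A" "\<And>i. i \<in> I \<Longrightarrow> x \<in> UA (\<mu> i) ` UO (F i)"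
    and D: "subobject C D \<iota> A" "UA \<iota> ` UO D = trivial_part A \<union> (\<Union>i\<in>I. UA (\<mu> i) ` UO (F i))"
  shows "indecomposable C D"
proof -
  note \<iota> = subobjectD[OF D(1)]
  have x\<iota>: "x \<in> UA \<iota> ` UO D" using I x D by blast
  then obtain d where d: "d \<in> UO D" "x = UA \<iota> d" by blast
  have d_triv: "d \<notin> trivial_part D" using d x UA_trivial_part[OF \<iota>(1)] by blast
  have noninit: "\<not> initial C D" using d d_triv initial_iff_trivial[OF \<iota>(4)] by blast
  have "\<exists>\<phi>. subobject C (F i) \<phi> D \<and> \<mu> i = \<iota> \<cdot> \<phi>" if "i \<in> I" for i
  proof -
    have "UA (\<mu> i) ` UO (F i) \<subseteq> UA \<iota> ` UO D" unfolding D(2) using that by auto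
    then show ?thesis using subobject_factor[OF S(1)[OF that] D(1)] by metis
  qed
  then obtain \<phi> where \<phi>: "\<And>i. i \<in> I \<Longrightarrow> subobject C (F i) (\<phi> i) D"
    "\<And>i. i \<in> I \<Longrightarrow> \<mu> i = \<iota> \<cdot> \<phi> i"
    by metis
  have im: "UA (\<mu> i) ` UO (F i) = UA \<iota> ` UA (\<phi> i) ` UO (F i)" if "i \<in> I" for i
    using UA_image_Comp[OF subobjectD(1)[OF \<phi>(1)] \<iota>(1)] \<phi>(2) that by simp
  have sub: "UA (\<phi> i) ` UO (F i) \<subseteq> UO D" if "i \<in> I" for i
    using subobjectD(1)[OF \<phi>(1)[OF that]] UA_mem by blast
  have d_mem: "d \<in> UA (\<phi> i) ` UO (F i)" if "i \<in> I" for i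
    using x(2)[OF that] im[OF that] d inj_on_image_mem_iff[OF \<iota>(3) d(1) sub[OF that]] by simp
  have D_cover: "UO D \<subseteq> trivial_part D \<union> (\<Union>i\<in>I. UA (\<phi> i) ` UO (F i))"
  proof
    fix y assume y: "y \<in> UO D"
    then consider "UA \<iota> y \<in> trivial_part A" | i where "i \<in> I" "UA \<iota> y \<in> UA (\<mu> i) ` UO (F i)"
      using D(2) by blast
    then show "y \<in> trivial_part D \<union> (\<Union>i\<in>I. UA (\<phi> i) ` UO (F i))"
    proof cases
      case 1
      then show ?thesis using trivial_part_subobject[OF D(1) y] by blast
    next
      case 2
      then show ?thesis
        using im inj_on_image_mem_iff[OF \<iota>(3) y sub] by auto
    qed
  qed
  have half: False
    if T: "subobject C T \<tau> D" and T': "subobject C T' \<tau>' D" "\<not> initial C T'"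
      and dj: "UA \<tau> ` UO T \<inter> UA \<tau>' ` UO T' \<subseteq> trivial_part D" and dT: "d \<in> UA \<tau> ` UO T"
      and alt: "\<And>i. i \<in> I \<Longrightarrow> UA (\<phi> i) ` UO (F i) \<subseteq> UA \<tau> ` UO T \<or>
        UA (\<phi> i) ` UO (F i) \<subseteq> UA \<tau>' ` UO T'"
    for T \<tau> T' \<tau>'
  proof -
    have "UA (\<phi> i) ` UO (F i) \<subseteq> UA \<tau> ` UO T" if "i \<in> I" for i
      using alt[OF that] d_mem[OF that] dT dj d_triv by blast
    then have "UO D \<subseteq> UA \<tau> ` UO T"
      using D_cover trivial_part_image[OF subobjectD(1)[OF T]]
      by (meson UN_least Un_least order_trans)
    moreover have "UA \<tau>' ` UO T' \<subseteq> UO D" using UA_mem subobjectD(1)[OF T'(1)] by blast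
    ultimately have "UA \<tau>' ` UO T' \<subseteq> trivial_part D" using dj by blast
    then have "UO T' \<subseteq> trivial_part T'" using trivial_part_subobject[OF T'(1)] by blast
    then show False using T' initial_iff_trivial subobjectD(4) by blast
  qed
  have False
    if A0: "\<not> initial C A0" and A1: "\<not> initial C A1" and cp: "is_coproduct2 C A0 A1 Q \<nu>0 \<nu>1"
      and iso: "isomorphic C D Q" for A0 A1 Q \<nu>0 \<nu>1
  proof -
    obtain f g where fg: "f \<in> Hom C D Q" "g \<in> Hom C Q D" "g \<cdot> f = Id C D" "f \<cdot> g = Id C Q"
      using iso by (elim isomorphicE)
    have "is_coproduct C {0, 1} (pair_family A0 A1) D (\<lambda>i. g \<cdot> pair_family \<nu>0 \<nu>1 i)"
      using cp is_coproduct_iso fg unfolding is_coproduct2_def by blast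
    from is_coproduct_two_indices[OF this]
    have cp': "is_coproduct2 C A0 A1 D (g \<cdot> \<nu>0) (g \<cdot> \<nu>1)" by simp
    note s = coproduct2_subobjects[OF cp'] and dj = coproduct2_disjoint[OF cp']
    have alt: "UA (\<phi> i) ` UO (F i) \<subseteq> UA (g \<cdot> \<nu>0) ` UO A0 \<or>
        UA (\<phi> i) ` UO (F i) \<subseteq> UA (g \<cdot> \<nu>1) ` UO A1" if "i \<in> I" for i
      using indecomposable_in_summand[OF cp'] S(2) \<phi>(1) that by blast
    consider "d \<in> UA (g \<cdot> \<nu>0) ` UO A0" | "d \<in> UA (g \<cdot> \<nu>1) ` UO A1"
      using coproduct2_cover[OF cp'] d(1) by blast
    then show False
    proof cases
      case 1
      then show False using half[OF s(1) s(2) A1 dj] alt by blast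
    next
      case 2
      then show False using half[OF s(2) s(1) A0] dj alt by blast
    qed
  qed
  then show ?thesis
    using \<iota>(4) noninit isomorphic_initial unfolding indecomposable_def by blast
qed

text \<open>
  With indecomposable subobjects in the role of connected subsets, this is an equivalence relation on
  the points outside the trivial part, and its classes are the components.
\<close>
definition linked :: "'o \<Rightarrow> 'e \<Rightarrow> 'e \<Rightarrow> bool" where
  "linked A x y \<longleftrightarrow> (\<exists>B \<nu>. subobject C B \<nu> A \<and> indecomposable C B \<and>
     x \<in> UA \<nu> ` UO B \<and> y \<in> UA \<nu> ` UO B)"

lemma linked_sym: "linked A x y \<Longrightarrow> linked A y x"
  unfolding linked_def by blast

lemma linked_refl:
  assumes "A \<in> Obj C" "x \<in> UO A" "x \<notin> trivial_part A"
  shows "linked A x x"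
  using UD6[OF assms(1) _ assms(2)] initial_iff_trivial[OF assms(1)] assms(2,3)
  unfolding linked_def by blast

lemma linked_mem: "linked A x y \<Longrightarrow> y \<in> UO A"
  unfolding linked_def using UA_mem subobjectD(1) by blast

text \<open>
  One indecomposable subobject is chosen for each point linked to \<open>x\<close>. Indexing by points
  instead of by subobjects keeps the family small.
\<close>
lemma component_exists:
  assumes A: "A \<in> Obj C" and x: "x \<in> UO A" "x \<notin> trivial_part A"
  shows "\<exists>D \<iota>. subobject C D \<iota> A \<and> indecomposable C D \<and>
    UA \<iota> ` UO D = trivial_part A \<union> {y. linked A x y}"
proof -
  let ?I = "{y. linked A x y}"
  have I: "small ?I" using linked_mem by (intro small_subset[OF UO_small[OF A]]) auto
  have "\<forall>y\<in>?I. \<exists>B \<nu>. subobject C B \<nu> A \<and> indecomposable C B \<and>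
     x \<in> UA \<nu> ` UO B \<and> y \<in> UA \<nu> ` UO B"
    by (simp add: linked_def)
  then obtain F \<mu> where F: "\<And>y. y \<in> ?I \<Longrightarrow> subobject C (F y) (\<mu> y) A"
    "\<And>y. y \<in> ?I \<Longrightarrow> indecomposable C (F y)" "\<And>y. y \<in> ?I \<Longrightarrow> x \<in> UA (\<mu> y) ` UO (F y)"
    "\<And>y. y \<in> ?I \<Longrightarrow> y \<in> UA (\<mu> y) ` UO (F y)"
    by metis
  obtain D \<iota> where D: "subobject C D \<iota> A"
    "UA \<iota> ` UO D = trivial_part A \<union> (\<Union>y\<in>?I. UA (\<mu> y) ` UO (F y))"
    using union_subobject[OF A I, of F \<mu>] F(1) by blast
  have "?I \<noteq> {}" using linked_refl[OF A x] by blast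
  then have "indecomposable C D" using union_indecomposable[OF _ F(1,2) x(2) F(3) D] by simp
  moreover have "(\<Union>y\<in>?I. UA (\<mu> y) ` UO (F y)) = ?I"
  proof
    show "?I \<subseteq> (\<Union>y\<in>?I. UA (\<mu> y) ` UO (F y))" using F(4) by blast
    show "(\<Union>y\<in>?I. UA (\<mu> y) ` UO (F y)) \<subseteq> ?I"
    proof
      fix z assume "z \<in> (\<Union>y\<in>?I. UA (\<mu> y) ` UO (F y))"
      then obtain y where "y \<in> ?I" "z \<in> UA (\<mu> y) ` UO (F y)" by blast
      then show "z \<in> ?I" using F(1-3)[of y] unfolding linked_def by blast
    qed
  qed
  ultimately show ?thesis using D by auto
qed

text \<open>Points linked to a common nontrivial point lie together in the component of that point.\<close>
lemma linked_trans:
  assumes A: "A \<in> Obj C" and y: "y \<notin> trivial_part A" and xy: "linked A x y" and yz: "linked A y z"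
  shows "linked A x z"
proof -
  obtain D \<iota> where "subobject C D \<iota> A" "indecomposable C D"
    "UA \<iota> ` UO D = trivial_part A \<union> {z. linked A y z}"
    using component_exists[OF A linked_mem[OF xy] y] by blast
  then show ?thesis using linked_sym[OF xy] yz unfolding linked_def[of A x z] by blast
qed

text \<open>
  Each class of linked points is represented by one of its points, so that the components are indexed
  by a small set. A nontrivial point in two components would link their representatives.
\<close>
lemma decomposition:
  assumes A: "A \<in> Obj C"
  obtains I :: "'e set" and F \<mu> where "small I"
    "\<And>i. i \<in> I \<Longrightarrow> subobject C (F i) (\<mu> i) A" "\<And>i. i \<in> I \<Longrightarrow> indecomposable C (F i)"
    "UO A \<subseteq> trivial_part A \<union> (\<Union>i\<in>I. UA (\<mu> i) ` UO (F i))"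
    "\<And>i j. i \<in> I \<Longrightarrow> j \<in> I \<Longrightarrow> i \<noteq> j \<Longrightarrow>
       UA (\<mu> i) ` UO (F i) \<inter> UA (\<mu> j) ` UO (F j) \<subseteq> trivial_part A"
proof -
  let ?X = "UO A - trivial_part A"
  define rep where "rep x = (SOME y. y \<in> ?X \<and> linked A x y)" for x
  have rep: "rep x \<in> ?X" "linked A x (rep x)" if "x \<in> ?X" for x
  proof -
    have "\<exists>y. y \<in> ?X \<and> linked A x y" using that linked_refl[OF A] by blast
    then have "rep x \<in> ?X \<and> linked A x (rep x)" unfolding rep_def by (rule someI_ex)
    then show "rep x \<in> ?X" "linked A x (rep x)" by auto
  qed
  have rep_eq: "rep x = rep y" if "x \<in> ?X" "y \<in> ?X" "linked A x y" for x y
  proof -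
    have "linked A x z \<longleftrightarrow> linked A y z" for z
      using that linked_trans[OF A] linked_sym by (metis DiffD2)
    then show ?thesis by (simp add: rep_def)
  qed
  define I where "I = rep ` ?X"
  have IX: "I \<subseteq> ?X" using rep(1) unfolding I_def by blast
  then have small: "small I" using small_subset[OF UO_small[OF A]] by blast
  have "\<forall>i\<in>I. \<exists>D \<iota>. subobject C D \<iota> A \<and> indecomposable C D \<and>
    UA \<iota> ` UO D = trivial_part A \<union> {y. linked A i y}"
    using component_exists[OF A] IX by blast
  then obtain F \<mu> where F: "\<And>i. i \<in> I \<Longrightarrow> subobject C (F i) (\<mu> i) A"
    "\<And>i. i \<in> I \<Longrightarrow> indecomposable C (F i)"
    "\<And>i. i \<in> I \<Longrightarrow> UA (\<mu> i) ` UO (F i) = trivial_part A \<union> {y. linked A i y}"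
    by metis
  have cover: "UO A \<subseteq> trivial_part A \<union> (\<Union>i\<in>I. UA (\<mu> i) ` UO (F i))"
  proof
    fix x assume "x \<in> UO A"
    then consider "x \<in> trivial_part A" | "x \<in> ?X" by blast
    then show "x \<in> trivial_part A \<union> (\<Union>i\<in>I. UA (\<mu> i) ` UO (F i))"
    proof cases
      case 2
      then have "rep x \<in> I" "linked A (rep x) x" using rep(2) linked_sym I_def by auto
      then show ?thesis using F(3) by blast
    qed blast
  qed
  have disj: "UA (\<mu> i) ` UO (F i) \<inter> UA (\<mu> j) ` UO (F j) \<subseteq> trivial_part A"
    if ij: "i \<in> I" "j \<in> I" "i \<noteq> j" for i j
  proof (rule ccontr)
    assume "\<not> ?thesis"
    then obtain y where y: "y \<notin> trivial_part A" "linked A i y" "linked A j y"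
      using F(3) ij by auto
    then have "linked A i j" using linked_trans[OF A] linked_sym by blast
    moreover obtain x x' where x: "x \<in> ?X" "i = rep x" "x' \<in> ?X" "j = rep x'"
      using ij I_def by blast
    ultimately have "rep i = rep j" using rep_eq IX ij by blast
    moreover have "rep i = i" "rep j = j" using rep_eq[OF _ _ rep(2)] rep(1) x by metis+
    ultimately show False using ij by simp
  qed
  show thesis using that[OF small F(1,2) cover disj] by blast
qed

section \<open>Summands of projective objects\<close>

text \<open>
  A summand \<open>S\<close> of \<open>P = S \<squnion> T\<close> need not be a retract of \<open>P\<close>. For an epimorphism \<open>\<pi> : A \<rightarrow> B\<close> and
  \<open>\<alpha> : S \<rightarrow> B\<close>, the morphism \<open>\<alpha> \<squnion> id\<close> lifts along the epimorphism
  \<open>\<pi> \<squnion> id : A \<squnion> T \<rightarrow> B \<squnion> T\<close>. The lift maps \<open>S\<close> into \<open>A\<close>: if the lift sends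
  a point into \<open>T\<close>, then \<open>\<alpha> \<squnion> id\<close> sends it into both \<open>B\<close> and \<open>T\<close>, so the lifted point belongs
  to the trivial part of \<open>A \<squnion> T\<close>, which \<open>A\<close> contains.
\<close>
lemma projective_summand:
  assumes P: "projective C P" and cp: "is_coproduct2 C S T P \<sigma> \<tau>"
  shows "projective C S"
  unfolding projective_def
proof (intro conjI allI ballI impI)
  have ST: "S \<in> Obj C" "T \<in> Obj C" "\<sigma> \<in> Hom C S P" "\<tau> \<in> Hom C T P"
    using cp by (auto simp: is_coproduct2_iff)
  then show "S \<in> Obj C" by blast
  fix A B \<pi> \<alpha> assume \<pi>: "\<pi> \<in> Hom C A B" "epi_arr C \<pi>" and \<alpha>: "\<alpha> \<in> Hom C S B"
  obtain Q a t where Q: "is_coproduct2 C A T Q a t"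
    using coproduct2_exists HomD(4)[OF \<pi>(1)] ST(2) by blast
  obtain R b t' where R: "is_coproduct2 C B T R b t'"
    using coproduct2_exists HomD(5)[OF \<pi>(1)] ST(2) by blast
  have at: "a \<in> Hom C A Q" "t \<in> Hom C T Q" and bt: "b \<in> Hom C B R" "t' \<in> Hom C T R"
    and RO: "R \<in> Obj C"
    using Q R by (auto simp: is_coproduct2_iff)
  have b\<pi>: "b \<cdot> \<pi> \<in> Hom C A R" and b\<alpha>: "b \<cdot> \<alpha> \<in> Hom C S R" using Comp_Hom bt \<pi> \<alpha> by blast+
  have "\<exists>!h. h \<in> Hom C Q R \<and> h \<cdot> a = b \<cdot> \<pi> \<and> h \<cdot> t = t'"
    using Q RO b\<pi> bt(2) unfolding is_coproduct2_iff by blast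
  then obtain p where p: "p \<in> Hom C Q R" "p \<cdot> a = b \<cdot> \<pi>" "p \<cdot> t = t'" by blast
  have "\<exists>!h. h \<in> Hom C P R \<and> h \<cdot> \<sigma> = b \<cdot> \<alpha> \<and> h \<cdot> \<tau> = t'"
    using cp RO b\<alpha> bt(2) unfolding is_coproduct2_iff by blast
  then obtain q where q: "q \<in> Hom C P R" "q \<cdot> \<sigma> = b \<cdot> \<alpha>" by blast
  have "epi_arr C p"
    unfolding epi_arr_iff[OF p(1)]
  proof (intro allI ballI impI)
    fix X g h assume g: "g \<in> Hom C R X" and h: "h \<in> Hom C R X" and eq: "g \<cdot> p = h \<cdot> p"
    have "(g \<cdot> b) \<cdot> \<pi> = (h \<cdot> b) \<cdot> \<pi>"
      using Comp_assoc[OF \<pi>(1) bt(1)] Comp_assoc[OF at(1) p(1)] g h eq p(2) by metis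
    then have gb: "g \<cdot> b = h \<cdot> b"
      using \<pi>(2) epi_arr_iff[OF \<pi>(1)] Comp_Hom[OF bt(1)] g h by blast
    have gt: "g \<cdot> t' = h \<cdot> t'"
      using Comp_assoc[OF at(2) p(1)] g h eq p(3) by metis
    have "h \<cdot> b \<in> Hom C B X" "h \<cdot> t' \<in> Hom C T X" "X \<in> Obj C"
      using Comp_Hom bt h HomD(5) by blast+
    then have "\<exists>!k. k \<in> Hom C R X \<and> k \<cdot> b = h \<cdot> b \<and> k \<cdot> t' = h \<cdot> t'"
      using R unfolding is_coproduct2_iff by blast
    then show "g = h" using g h gb gt by metis
  qed
  then obtain l where l: "l \<in> Hom C P Q" "q = p \<cdot> l"
    using projective_lift[OF P p(1) _ q(1)] by blast
  have l\<sigma>: "l \<cdot> \<sigma> \<in> Hom C S Q" using Comp_Hom ST l by blast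
  have pl: "p \<cdot> (l \<cdot> \<sigma>) = b \<cdot> \<alpha>" using Comp_assoc[OF ST(3) l(1) p(1)] l q by simp
  have sub: "UA (l \<cdot> \<sigma>) ` UO S \<subseteq> UA a ` UO A"
  proof
    fix y assume "y \<in> UA (l \<cdot> \<sigma>) ` UO S"
    then obtain s where s: "s \<in> UO S" "y = UA (l \<cdot> \<sigma>) s" by blast
    then have yQ: "y \<in> UO Q" using UA_mem[OF l\<sigma>] by blast
    have py: "UA p y = UA b (UA \<alpha> s)"
      using UA_Comp[OF l\<sigma> p(1) s(1)] UA_Comp[OF \<alpha> bt(1) s(1)] pl s(2) by simp
    consider "y \<in> UA a ` UO A" | z where "z \<in> UO T" "y = UA t z"
      using coproduct2_cover[OF Q] yQ by blast
    then show "y \<in> UA a ` UO A"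
    proof cases
      case 2
      then have pz: "UA p y = UA t' z" using UA_Comp[OF at(2) p(1)] p(3) by metis
      have "UA t' z \<in> UA b ` UO B \<inter> UA t' ` UO T"
        using py pz UA_mem[OF \<alpha> s(1)] 2(1) by (metis IntI imageI)
      then have "z \<in> trivial_part T"
        using coproduct2_disjoint[OF R] trivial_part_subobject[OF coproduct2_subobjects(2)[OF R] 2(1)]
        by blast
      then have "y \<in> trivial_part Q" using UA_trivial_part[OF at(2)] 2(2) by blast
      then show ?thesis using trivial_part_image[OF at(1)] by blast
    qed
  qed
  obtain \<gamma> where \<gamma>: "\<gamma> \<in> Hom C S A" "l \<cdot> \<sigma> = a \<cdot> \<gamma>"
    using UD3[OF l\<sigma> coproduct2_subobjects(1)[OF Q] sub] by blast
  have "b \<cdot> (\<pi> \<cdot> \<gamma>) = b \<cdot> \<alpha>"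
    using Comp_assoc[OF \<gamma>(1) \<pi>(1) bt(1)] Comp_assoc[OF \<gamma>(1) at(1) p(1)] p(2) \<gamma>(2) pl by simp
  then have "\<pi> \<cdot> \<gamma> = \<alpha>"
    using subobjectD(2)[OF coproduct2_subobjects(1)[OF R]] mono_arr_iff[OF bt(1)]
      Comp_Hom[OF \<gamma>(1) \<pi>(1)] \<alpha> by blast
  then show "\<exists>\<beta> \<in> Hom C S A. \<alpha> = \<pi> \<cdot> \<beta>" using \<gamma>(1) by blast
qed

lemma projective_decomposition:
  assumes P: "projective C P"
  shows "\<exists>(I :: 'e set) F \<mu>. small I \<and>
    (\<forall>i\<in>I. indecomposable C (F i) \<and> projective C (F i)) \<and> is_coproduct C I F P \<mu>"
proof -
  have PO: "P \<in> Obj C" using P by (simp add: projective_def)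
  obtain I :: "'e set" and F \<mu> where I: "small I"
    and S: "\<And>i. i \<in> I \<Longrightarrow> subobject C (F i) (\<mu> i) P" "\<And>i. i \<in> I \<Longrightarrow> indecomposable C (F i)"
    and cover: "UO P \<subseteq> trivial_part P \<union> (\<Union>i\<in>I. UA (\<mu> i) ` UO (F i))"
    and disj: "\<And>i j. i \<in> I \<Longrightarrow> j \<in> I \<Longrightarrow> i \<noteq> j \<Longrightarrow>
       UA (\<mu> i) ` UO (F i) \<inter> UA (\<mu> j) ` UO (F j) \<subseteq> trivial_part P"
    by (rule decomposition[OF PO]) blast
  have "projective C (F i)" if i: "i \<in> I" for i
  proof -
    have J: "small (I - {i})" using small_subset[OF I] by blast
    \<comment> \<open>The union of the other components is a complement of \<open>F i\<close>.\<close>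
    obtain T \<tau> where T: "subobject C T \<tau> P"
      "UA \<tau> ` UO T = trivial_part P \<union> (\<Union>j\<in>I - {i}. UA (\<mu> j) ` UO (F j))"
      using union_subobject[OF PO J, of F \<mu>] S(1) by blast
    have "is_coproduct2 C (F i) T P (\<mu> i) \<tau>"
    proof (rule internal_coproduct2[OF S(1)[OF i] T(1)])
      show "UO P \<subseteq> UA (\<mu> i) ` UO (F i) \<union> UA \<tau> ` UO T" using cover T(2) by blast
      show "UA (\<mu> i) ` UO (F i) \<inter> UA \<tau> ` UO T \<subseteq> trivial_part P"
        using disj[OF i] T(2) by blast
    qed
    then show ?thesis using projective_summand[OF P] by blast
  qed
  moreover have "is_coproduct C I F P \<mu>" by (rule internal_coproduct[OF PO I S(1) cover disj])
  ultimately show ?thesis using I S(2) by blast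
qed

end

section \<open>Projective objects\<close>

theorem theorem4p3:
  fixes C :: "('o, 'm) cat" and small :: "'e set \<Rightarrow> bool"
    and UO :: "'o \<Rightarrow> 'e set" and UA :: "'m \<Rightarrow> 'e \<Rightarrow> 'e" and P :: 'o
  assumes "UD_category C small UO UA" and "P \<in> Obj C"
  shows "projective C P \<longleftrightarrow>
    (\<exists>(I :: 'e set) F Q \<nu>. small I \<and>
       (\<forall>i\<in>I. indecomposable C (F i) \<and> projective C (F i)) \<and>
       is_coproduct C I F Q \<nu> \<and> isomorphic C P Q)"
proof -
  interpret UD_category C small UO UA by fact
  show ?thesis
    using projective_decomposition isomorphic_refl[OF assms(2)]
      projective_coproduct projective_isomorphic by meson
qed

end
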